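(* Let $G=(V,E)$ be a finite simple graph and let $w\in\mathbb{R}_+^E$ be nonzero. Then there exist a nonzero $z\in\mathfrak Z_G(w)$ and an $\alpha_{GW}$-certificate for $(w,z)$.
   Context: For $S\subseteq V$, $\delta(S)\subseteq E$ is the set of edges with exactly one endpoint in $S$, $\chi^{\delta(S)}\in\{0,1\}^E$ its incidence vector, $\mathbf 1$ the all-ones vector, $\mathcal P(V)$ the power set. $\mathbb{S}^V_+$ is the cone of positive semidefinite symmetric $V\times V$ matrices, $A\succeq B$ means $A-B\in\mathbb{S}^V_+$, $\langle A,B\rangle=\mathrm{tr}(A^TB)$, $\mathcal L_G(w):=\sum_{ij\in E}w_{ij}(e_i-e_j)(e_i-e_j)^T$, $(\mathcal L_G^*(Y))_{ij}=Y_{ii}+Y_{jj}-Y_{ij}-Y_{ji}$ for $ij\in E$, and $\mathrm{Diag}(x)$ is the diagonal matrix with diagonal $x$. For $w,z\in\mathbb{R}_+^E$: $\mathrm{GW}(G,w):=\max\{\langle\tfrac14\mathcal L_G(w),Y\rangle : Y\in\mathbb{S}^V_+,\ \mathrm{diag}(Y)=\mathbf 1\}$; $\mathrm{GW}^\circ(G,z):=\min\{\mu:\mu\in\mathbb{R}_+,\ Y\in\mathbb{S}^V_+,\ \mathrm{diag}(Y)=\mu\mathbf 1,\ \tfrac14\mathcal L_G^*(Y)\ge z\}$. Define $\mathfrak Z_G(w):=\{z\in\mathbb{R}_+^E : w^Tz=\mathrm{GW}(G,w)\,\mathrm{GW}^\circ(G,z)\}$. The constant is $\alpha_{GW}:=\min_{0<\vartheta\le\pi}\frac{2}{\pi}\frac{\vartheta}{1-\cos\vartheta}\approx0.878$.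 For $\beta\in(0,1]$, a $\beta$-certificate for $(w,z)\in\mathbb{R}_+^E\times\mathbb{R}_+^E$ is a tuple $(\rho,\mu,S,y,x)$ such that $\rho=0=\mu$ if and only if $w=0=z$, and: (i) $\rho,\mu\in\mathbb{R}_+$ and $\rho\mu=w^Tz$; (ii) $S\subseteq V$ and $w^T\chi^{\delta(S)}\ge\beta\rho$; (iii) $y\in\mathbb{R}_+^{\mathcal P(V)}$, $\sum_{U\subseteq V}y_U\chi^{\delta(U)}\ge z$ and $\mathbf 1^Ty\le\frac1\beta\mu$; (iv) $x\in\mathbb{R}^V$, $\rho\ge\mathbf 1^Tx$ and $\mathrm{Diag}(x)\succeq\tfrac14\mathcal L_G(w)$. *)

theory Defs
  imports "HOL-Analysis.Analysis"
begin

text \<open>The vertex set is a finite type \<open>'v\<close>. A graph is given by its set of edges, each edge being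
  a two-element set of vertices. A vector indexed by the edges is a function on \<open>'v set\<close>, of which
  only the values on \<open>E\<close> are ever used.\<close>

definition simple_graph :: "'v::finite set set \<Rightarrow> bool" where
  "simple_graph E \<longleftrightarrow> (\<forall>e\<in>E. card e = 2)"

definition nonneg_on :: "'e set \<Rightarrow> ('e \<Rightarrow> real) \<Rightarrow> bool" where
  "nonneg_on E w \<longleftrightarrow> (\<forall>e\<in>E. 0 \<le> w e)"

definition zero_on :: "'e set \<Rightarrow> ('e \<Rightarrow> real) \<Rightarrow> bool" where
  "zero_on E w \<longleftrightarrow> (\<forall>e\<in>E. w e = 0)"

definition cut :: "'v::finite set set \<Rightarrow> 'v set \<Rightarrow> 'v set set" where
  "cut E S = {e \<in> E. card (e \<inter> S) = 1}"

definition psd :: "real^'v^'v::finite \<Rightarrow> bool" where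
  "psd A \<longleftrightarrow> transpose A = A \<and> (\<forall>x. 0 \<le> x \<bullet> (A *v x))"

definition trace_inner :: "real^'v^'v::finite \<Rightarrow> real^'v^'v \<Rightarrow> real" where
  "trace_inner A B = trace (transpose A ** B)"

definition Diag :: "real^'v::finite \<Rightarrow> real^'v^'v" where
  "Diag x = (\<chi> i j. if i = j then x $ i else 0)"

definition outer :: "real^'v::finite \<Rightarrow> real^'v \<Rightarrow> real^'v^'v" where
  "outer u v = (\<chi> i j. u $ i * v $ j)"

text \<open>The sum runs over ordered pairs of adjacent vertices, so each edge contributes twice the same
  term; hence the factor \<open>1/2\<close>.\<close>

definition laplacian :: "'v::finite set set \<Rightarrow> ('v set \<Rightarrow> real) \<Rightarrow> real^'v^'v" where
  "laplacian E w = (1/2) *\<^sub>R (\<Sum>(i, j) | {i, j} \<in> E.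
     w {i, j} *\<^sub>R outer (axis i 1 - axis j 1) (axis i 1 - axis j 1))"

text \<open>The value is symmetric in \<open>i\<close> and \<open>j\<close> even for non-symmetric \<open>Y\<close>,
  so it only depends on the edge \<open>{i, j}\<close>.\<close>

definition laplacian_adj :: "real^'v^'v::finite \<Rightarrow> 'v \<Rightarrow> 'v \<Rightarrow> real" where
  "laplacian_adj Y i j = Y $ i $ i + Y $ j $ j - Y $ i $ j - Y $ j $ i"

definition GW :: "'v::finite set set \<Rightarrow> ('v set \<Rightarrow> real) \<Rightarrow> real" where
  "GW E w = (GREATEST t. \<exists>Y. psd Y \<and> (\<forall>i. Y $ i $ i = 1) \<and>
     t = trace_inner ((1/4) *\<^sub>R laplacian E w) Y)"

definition GW_polar :: "'v::finite set set \<Rightarrow> ('v set \<Rightarrow> real) \<Rightarrow> real" where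
  "GW_polar E z = (LEAST \<mu>. 0 \<le> \<mu> \<and> (\<exists>Y. psd Y \<and> (\<forall>i. Y $ i $ i = \<mu>) \<and>
     (\<forall>i j. {i, j} \<in> E \<longrightarrow> z {i, j} \<le> (1/4) * laplacian_adj Y i j)))"

definition Z_set :: "'v::finite set set \<Rightarrow> ('v set \<Rightarrow> real) \<Rightarrow> ('v set \<Rightarrow> real) set" where
  "Z_set E w = {z. nonneg_on E z \<and> (\<Sum>e\<in>E. w e * z e) = GW E w * GW_polar E z}"

definition alpha_GW :: real where
  "alpha_GW = (LEAST t. \<exists>\<theta>. 0 < \<theta> \<and> \<theta> \<le> pi \<and> t = (2 / pi) * (\<theta> / (1 - cos \<theta>)))"

definition is_certificate ::
  "real \<Rightarrow> 'v::finite set set \<Rightarrow> ('v set \<Rightarrow> real) \<Rightarrow> ('v set \<Rightarrow> real) \<Rightarrow>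
   real \<times> real \<times> 'v set \<times> ('v set \<Rightarrow> real) \<times> (real^'v) \<Rightarrow> bool" where
  "is_certificate \<beta> E w z = (\<lambda>(\<rho>, \<mu>, S, y, x).
     0 < \<beta> \<and> \<beta> \<le> 1 \<and> nonneg_on E w \<and> nonneg_on E z \<and>
     ((\<rho> = 0 \<and> \<mu> = 0) \<longleftrightarrow> (zero_on E w \<and> zero_on E z)) \<and>
     0 \<le> \<rho> \<and> 0 \<le> \<mu> \<and> \<rho> * \<mu> = (\<Sum>e\<in>E. w e * z e) \<and>
     (\<Sum>e\<in>E. w e * indicator (cut E S) e) \<ge> \<beta> * \<rho> \<and>
     (\<forall>U. 0 \<le> y U) \<and>
     (\<forall>e\<in>E. (\<Sum>U\<in>UNIV. y U * indicator (cut E U) e) \<ge> z e) \<and>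
     (\<Sum>U\<in>UNIV. y U) \<le> (1 / \<beta>) * \<mu> \<and>
     \<rho> \<ge> (\<Sum>i\<in>UNIV. x $ i) \<and>
     psd (Diag x - (1/4) *\<^sub>R laplacian E w))"

end

theory Submission
  imports Defs
begin

text \<open>
  Take an optimal solution \<open>Y\<close> of the semidefinite program for \<open>GW E w\<close>, put \<open>\<rho> = GW E w\<close>, \<open>\<mu> = 1\<close>,
  and let \<open>z\<close> be a quarter of the adjoint Laplacian of \<open>Y\<close>. Then \<open>\<langle>w, z\<rangle> = \<rho>\<close>, \<open>Y\<close> shows that the polar
  value of \<open>z\<close> is at most \<open>1\<close>, and weak duality shows that it is at least \<open>1\<close>. The vector \<open>x\<close> is
  an optimal dual solution. Writing \<open>Y\<close> as a Gram matrix of unit vectors, a random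
  hyperplane separates the vectors of \<open>i\<close> and \<open>j\<close> with probability \<open>arccos Y\<^sub>i\<^sub>j / \<pi> \<ge> \<alpha> z\<^sub>i\<^sub>j\<close>. The
  distribution of the resulting cut, scaled by \<open>1 / \<alpha>\<close>, is the fractional cover \<open>y\<close>, and a maximum
  cut \<open>S\<close> weighs at least the expected weight, which is at least \<open>\<alpha> \<rho>\<close>.

  The normal of the hyperplane is drawn uniformly from the unit ball. Instead of computing the
  volume of a sector, we use that the volume separating two points of a great circle is
  rotation-invariant, subadditive in the angle, and superadditive below \<open>\<pi>\<close>.
\<close>

subsection \<open>Random hyperplanes\<close>

text \<open>The points \<open>x\<close> are normals of hyperplanes, taken from the ball so that
  Lebesgue measure applies. A vector lying on the hyperplane counts as being on the negative side,
  so every hyperplane splits all vectors into two classes.\<close>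

definition separated :: "'a::euclidean_space \<Rightarrow> 'a \<Rightarrow> 'a set" where
  "separated u v = {x \<in> ball 0 1. (0 < u \<bullet> x) \<noteq> (0 < v \<bullet> x)}"

text \<open>For varying \<open>U\<close> these cells partition the ball; their relative volumes
  become the probabilities of the cuts.\<close>

definition half_ball_pattern :: "('i \<Rightarrow> 'a::euclidean_space) \<Rightarrow> 'i set \<Rightarrow> 'a set" where
  "half_ball_pattern v U = {x \<in> ball 0 1. {i. 0 < v i \<bullet> x} = U}"

definition circle_point :: "'a::euclidean_space \<Rightarrow> 'a \<Rightarrow> real \<Rightarrow> 'a" where
  "circle_point a b t = cos t *\<^sub>R a + sin t *\<^sub>R b"

lemma separated_lmeasurable [simp]: "separated u v \<in> lmeasurable"
proof -
  have "separated u v \<in> sets borel"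
    unfolding separated_def by measurable
  moreover have "bounded (separated u v)"
    by (rule bounded_subset[of "ball 0 1"]) (auto simp: separated_def)
  ultimately show ?thesis
    by (simp add: bounded_set_imp_lmeasurable)
qed

lemma half_ball_pattern_lmeasurable [simp]:
  fixes v :: "'i::finite \<Rightarrow> 'a::euclidean_space"
  shows "half_ball_pattern v U \<in> lmeasurable"
proof -
  have "half_ball_pattern v U = {x \<in> ball 0 1. \<forall>i. (0 < v i \<bullet> x) = (i \<in> U)}"
    unfolding half_ball_pattern_def by auto
  also have "\<dots> \<in> sets borel"
    by measurable
  finally have "half_ball_pattern v U \<in> sets borel" .
  moreover have "bounded (half_ball_pattern v U)"
    by (rule bounded_subset[of "ball 0 1"]) (auto simp: half_ball_pattern_def)
  ultimately show ?thesis
    by (simp add: bounded_set_imp_lmeasurable)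
qed

section \<open>Symmetry and additivity of the separated volume\<close>

lemma separated_commute: "separated u v = separated v u"
  by (auto simp: separated_def)

text \<open>If a hyperplane separates \<open>u\<close> from \<open>w\<close>, then it separates
  \<open>v\<close> from one of the two.\<close>

lemma measure_separated_triangle:
  "measure lebesgue (separated u w)
    \<le> measure lebesgue (separated u v) + measure lebesgue (separated v w)"
proof -
  have "measure lebesgue (separated u w) \<le> measure lebesgue (separated u v \<union> separated v w)"
    by (intro measure_mono_fmeasurable fmeasurable.Un fmeasurableD separated_lmeasurable)
      (auto simp: separated_def)
  also have "\<dots> \<le> measure lebesgue (separated u v) + measure lebesgue (separated v w)"
    by (rule measure_Un_le) (auto intro: fmeasurableD)
  finally show ?thesis .
qed

lemma measure_separated_orthogonal:
  fixes T :: "real^'n::{finite,wellorder} \<Rightarrow> real^'n::_"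
  assumes T: "orthogonal_transformation T"
  shows "measure lebesgue (separated (T u) (T v)) = measure lebesgue (separated u v)"
proof -
  have inner: "T x \<bullet> T y = x \<bullet> y" for x y
    using T by (simp add: orthogonal_transformation_def)
  have norm: "norm (T x) = norm x" for x
    using T by (simp add: orthogonal_transformation_norm)
  have "separated (T u) (T v) = T ` separated u v"
  proof (intro equalityI subsetI)
    fix x assume x: "x \<in> separated (T u) (T v)"
    obtain y where "x = T y"
      using orthogonal_transformation_surj[OF T] by blast
    with x show "x \<in> T ` separated u v"
      by (auto simp: separated_def inner norm)
  qed (auto simp: separated_def inner norm)
  then show ?thesis
    by (simp add: measure_orthogonal_image T)
qed

lemma orthogonal_transformation_reflection:
  fixes n :: "'a::euclidean_space"
  assumes "norm n = 1"
  shows "orthogonal_transformation (\<lambda>x. x - (2 * (n \<bullet> x)) *\<^sub>R n)"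
proof -
  have "n \<bullet> n = 1"
    using assms by (simp add: norm_eq_1)
  then show ?thesis
    unfolding orthogonal_transformation_def
    by (auto intro!: linearI simp: algebra_simps inner_commute)
qed

text \<open>Within the plane of the circle, \<open>n h\<close> is normal to the line at angle
  \<open>h\<close>. Rotations are replaced by such reflections because a reflection of the whole
  space is given by its normal alone.\<close>

lemma circle_point_reflection:
  fixes a b :: "'a::euclidean_space"
  assumes "norm a = 1" "norm b = 1" "a \<bullet> b = 0"
  defines "n h \<equiv> circle_point a b (h + pi / 2)"
  shows "norm (n h) = 1"
    and "circle_point a b s - (2 * (n h \<bullet> circle_point a b s)) *\<^sub>R n h = circle_point a b (2 * h - s)"
proof -
  have ab: "a \<bullet> a = 1" "b \<bullet> b = 1" "b \<bullet> a = 0"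
    using assms by (auto simp: norm_eq_1 inner_commute)
  have n: "n h = cos h *\<^sub>R b - sin h *\<^sub>R a"
    by (simp add: n_def circle_point_def sin_add cos_add)
  have "n h \<bullet> n h = 1"
    by (simp add: n algebra_simps ab assms(3) flip: power2_eq_square)
  then show "norm (n h) = 1"
    by (simp add: norm_eq_1)
  have ip: "n h \<bullet> circle_point a b s = sin (s - h)"
    by (simp add: n circle_point_def algebra_simps ab assms(3) sin_diff)
  have c: "cos s + 2 * sin (s - h) * sin h = cos (2 * h - s)"
    using sin_times_sin[of "s - h" h] cos_minus[of "2 * h - s"] by (simp add: algebra_simps)
  have s: "sin s - 2 * sin (s - h) * cos h = sin (2 * h - s)"
    using sin_times_cos[of "s - h" h] sin_minus[of "2 * h - s"] by (simp add: algebra_simps)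
  have "circle_point a b s - (2 * (n h \<bullet> circle_point a b s)) *\<^sub>R n h
    = (cos s + 2 * sin (s - h) * sin h) *\<^sub>R a + (sin s - 2 * sin (s - h) * cos h) *\<^sub>R b"
    unfolding ip unfolding n circle_point_def by (simp add: algebra_simps)
  then show "circle_point a b s - (2 * (n h \<bullet> circle_point a b s)) *\<^sub>R n h = circle_point a b (2 * h - s)"
    unfolding c s by (simp add: circle_point_def)
qed

lemma measure_separated_rotate:
  fixes a b :: "real^'n::{finite,wellorder}"
  assumes ab: "norm a = 1" "norm b = 1" "a \<bullet> b = 0"
  shows "measure lebesgue (separated (circle_point a b (s + r)) (circle_point a b (t + r)))
    = measure lebesgue (separated (circle_point a b s) (circle_point a b t))"
proof -
  txt \<open>The reflection that exchanges the angles \<open>s\<close> and \<open>t + r\<close> also exchanges \<open>t\<close> and \<open>s + r\<close>.\<close>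
  define h where "h = (s + t + r) / 2"
  define n where "n = circle_point a b (h + pi / 2)"
  have n1: "norm n = 1"
    unfolding n_def by (rule circle_point_reflection(1)[OF ab])
  have T: "circle_point a b x - (2 * (n \<bullet> circle_point a b x)) *\<^sub>R n = circle_point a b (2 * h - x)" for x
    unfolding n_def by (rule circle_point_reflection(2)[OF ab])
  have h: "2 * h - s = t + r" "2 * h - t = s + r"
    unfolding h_def by argo+
  show ?thesis
    using measure_separated_orthogonal[OF orthogonal_transformation_reflection[OF n1],
        of "circle_point a b t" "circle_point a b s"]
    unfolding T h separated_commute[of "circle_point a b t"] .
qed

text \<open>Below the angle pi, the middle point is a positive combination of the outer two, so it
  lies on their side whenever they share one. Hence the two smaller separating sets are disjoint and
  both lie in the large one.\<close>

lemma measure_separated_superadditive: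
  fixes a b :: "'a::euclidean_space"
  assumes st: "s \<le> t" "t \<le> r" and rs: "r - s < pi"
  shows "measure lebesgue (separated (circle_point a b s) (circle_point a b t))
      + measure lebesgue (separated (circle_point a b t) (circle_point a b r))
    \<le> measure lebesgue (separated (circle_point a b s) (circle_point a b r))"
proof (cases "s = t \<or> t = r")
  case True
  then show ?thesis by (auto simp: separated_def)
next
  case False
  then have pos: "0 < sin (r - s)" "0 < sin (r - t)" "0 < sin (t - s)"
    using st rs by (auto intro!: sin_gt_zero)
  let ?p = "circle_point a b"
  \<comment> \<open>The addition formula for sine expresses the middle point through the outer ones,
    up to the positive factor \<open>sin (r - s)\<close>.\<close>
  have id: "(?p t \<bullet> x) * sin (r - s) = (?p s \<bullet> x) * sin (r - t) + (?p r \<bullet> x) * sin (t - s)" for x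
  proof -
    have "cos t * sin (r - s) = cos s * sin (r - t) + cos r * sin (t - s)"
      "sin t * sin (r - s) = sin s * sin (r - t) + sin r * sin (t - s)"
      unfolding sin_diff by algebra+
    then show ?thesis
      unfolding circle_point_def inner_add_left inner_scaleR_left by algebra
  qed
  have 1: "0 < ?p t \<bullet> x" if "0 < ?p s \<bullet> x" "0 < ?p r \<bullet> x" for x
    using id[of x] pos that by (metis add_pos_pos mult_pos_pos zero_less_mult_pos2)
  have 2: "\<not> 0 < ?p t \<bullet> x" if "\<not> 0 < ?p s \<bullet> x" "\<not> 0 < ?p r \<bullet> x" for x
  proof
    assume "0 < ?p t \<bullet> x"
    then have "0 < (?p t \<bullet> x) * sin (r - s)"
      using pos by simp
    moreover have "(?p s \<bullet> x) * sin (r - t) \<le> 0" "(?p r \<bullet> x) * sin (t - s) \<le> 0"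
      using that pos by (auto intro!: mult_nonpos_nonneg)
    ultimately show False
      using id[of x] by linarith
  qed
  have "separated (?p s) (?p t) \<inter> separated (?p t) (?p r) = {}"
    using 1 2 by (auto simp: separated_def)
  then have "measure lebesgue (separated (?p s) (?p t)) + measure lebesgue (separated (?p t) (?p r))
    = measure lebesgue (separated (?p s) (?p t) \<union> separated (?p t) (?p r))"
    by (simp add: measure_Un3)
  also have "\<dots> \<le> measure lebesgue (separated (?p s) (?p r))"
    by (intro measure_mono_fmeasurable fmeasurableD fmeasurable.Un separated_lmeasurable)
      (use 1 2 in \<open>auto simp: separated_def\<close>)
  finally show ?thesis .
qed

text \<open>A normal in the ball fails to separate \<open>u\<close> from \<open>- u\<close> only if
  it is orthogonal to \<open>u\<close>, and these normals form a null set.\<close>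

lemma measure_separated_antipodal:
  fixes u :: "'a::euclidean_space"
  assumes "u \<noteq> 0"
  shows "measure lebesgue (separated u (- u)) = measure lebesgue (ball (0::'a) 1)"
proof -
  have "negligible {x. u \<bullet> x = 0}"
    using assms by (intro negligible_hyperplane) auto
  moreover have "(ball 0 1 - separated u (- u)) \<union> (separated u (- u) - ball 0 1) \<subseteq> {x. u \<bullet> x = 0}"
    by (auto simp: separated_def)
  ultimately have "negligible ((separated u (- u) - ball 0 1) \<union> (ball 0 1 - separated u (- u)))"
    by (metis negligible_subset sup_commute)
  then show ?thesis
    by (intro measure_negligible_symdiff[symmetric]) (auto simp: Un_commute)
qed

text \<open>A grid of mesh \<open>pi / n\<close> replaces the exact volume of a sector: each grid
  step has at least the share \<open>1 / n\<close> of the ball, and as many steps as fit below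
  \<open>\<theta>\<close> are added up. The error vanishes as \<open>n\<close> grows.\<close>

lemma measure_separated_angle_ge:
  fixes a b :: "real^'n::{finite,wellorder}"
  assumes ab: "norm a = 1" "norm b = 1" "a \<bullet> b = 0" and \<theta>: "0 \<le> \<theta>" "\<theta> < pi"
  shows "\<theta> / pi * measure lebesgue (ball (0::real^'n::_) 1)
    \<le> measure lebesgue (separated a (circle_point a b \<theta>))"
proof -
  let ?p = "circle_point a b" and ?m = "measure lebesgue (ball (0::real^'n::_) 1)"
  define F where "F t = measure lebesgue (separated a (?p t))" for t
  have p0: "?p 0 = a"
    by (simp add: circle_point_def)
  have F_shift: "measure lebesgue (separated (?p s) (?p (s + t))) = F t" for s t
    using measure_separated_rotate[OF ab, of 0 s t] by (simp add: F_def p0 add.commute)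
  have F_le: "F (s + t) \<le> F s + F t" for s t
    using measure_separated_triangle[of a "?p (s + t)" "?p s"]
    unfolding F_def[symmetric] F_shift by simp
  have F_ge: "F s + F t \<le> F (s + t)" if "0 \<le> s" "0 \<le> t" "s + t < pi" for s t
    using measure_separated_superadditive[of 0 s "s + t" a b] that
    unfolding F_shift p0 F_def[symmetric] by simp
  have F_nonneg: "0 \<le> F t" for t
    by (simp add: F_def)
  have F_0: "F 0 = 0"
    by (simp add: F_def p0 separated_def)
  have F_mult_le: "F (of_nat k * t) \<le> of_nat k * F t" for k t
  proof (induction k)
    case (Suc k)
    then show ?case
      using F_le[of "of_nat k * t" t] by (simp add: algebra_simps)
  qed (simp add: F_0)
  have F_mult_ge: "of_nat k * F t \<le> F (of_nat k * t)" if "0 \<le> t" "of_nat k * t < pi" for k t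
    using that(2)
  proof (induction k)
    case (Suc k)
    then show ?case
      using F_ge[of "of_nat k * t" t] that(1) by (simp add: algebra_simps)
  qed (simp add: F_0)
  have "?p pi = - a"
    by (simp add: circle_point_def)
  then have F_pi: "F pi = ?m"
    unfolding F_def using measure_separated_antipodal[of a] ab(1) by fastforce
  have approx: "(\<theta> / pi - 1 / of_nat n) * ?m \<le> F \<theta>" if n: "0 < n" for n :: nat
  proof -
    define \<delta> where "\<delta> = pi / of_nat n"
    define k where "k = nat \<lfloor>\<theta> / \<delta>\<rfloor>"
    have \<delta>: "0 < \<delta>"
      using n by (simp add: \<delta>_def)
    have k: "of_nat k \<le> \<theta> / \<delta>" "\<theta> / \<delta> - 1 \<le> of_nat k"
      unfolding k_def using \<theta> \<delta> by (simp_all add: of_nat_nat)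
    have k\<theta>: "of_nat k * \<delta> \<le> \<theta>"
      using k(1) \<delta> by (simp add: pos_le_divide_eq)
    \<comment> \<open>The \<open>n\<close> steps reach pi itself, where superadditivity stops;
      subadditivity gives the direction needed here.\<close>
    have "?m \<le> of_nat n * F \<delta>"
      using F_mult_le[of n \<delta>] n by (simp add: \<delta>_def F_pi)
    then have "?m / of_nat n \<le> F \<delta>"
      using n by (simp add: divide_le_eq mult.commute)
    have "(\<theta> / pi - 1 / of_nat n) * ?m = (\<theta> / \<delta> - 1) * (?m / of_nat n)"
      using n by (simp add: \<delta>_def field_simps)
    also have "\<dots> \<le> of_nat k * (?m / of_nat n)"
      by (intro mult_right_mono k) simp
    also have "\<dots> \<le> of_nat k * F \<delta>"
      by (intro mult_left_mono \<open>?m / of_nat n \<le> F \<delta>\<close>) simp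
    also have "\<dots> \<le> F (of_nat k * \<delta>)"
      using \<delta> k\<theta> \<theta> by (intro F_mult_ge) auto
    also have "\<dots> \<le> F (of_nat k * \<delta>) + F (\<theta> - of_nat k * \<delta>)"
      using F_nonneg by simp
    also have "\<dots> \<le> F \<theta>"
      using F_ge[of "of_nat k * \<delta>" "\<theta> - of_nat k * \<delta>"] k\<theta> \<theta> \<delta> by simp
    finally show ?thesis .
  qed
  have "(\<lambda>n. (\<theta> / pi - 1 / of_nat n) * ?m) \<longlonglongrightarrow> (\<theta> / pi - 0) * ?m"
    by (intro tendsto_intros lim_1_over_n)
  then have "(\<theta> / pi - 0) * ?m \<le> F \<theta>"
    by (rule LIMSEQ_le_const2) (metis approx less_le_trans zero_less_one)
  then show ?thesis
    by (simp add: F_def)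
qed

text \<open>Gram-Schmidt places \<open>u\<close> and \<open>v\<close> on a common great circle at
  distance \<open>arccos (u \<bullet> v)\<close>. Equal and antipodal vectors span no plane and are
  treated apart.\<close>

lemma measure_separated_ge:
  fixes u v :: "real^'n::{finite,wellorder}"
  assumes u: "norm u = 1" and v: "norm v = 1"
  shows "arccos (u \<bullet> v) / pi * measure lebesgue (ball (0::real^'n::_) 1)
    \<le> measure lebesgue (separated u v)"
proof -
  define c where "c = u \<bullet> v"
  have uu: "u \<bullet> u = 1" "v \<bullet> v = 1"
    using u v by (auto simp: norm_eq_1)
  have c: "\<bar>c\<bar> \<le> 1"
    using Cauchy_Schwarz_ineq2[of u v] u v by (simp add: c_def)
  consider "c = 1" | "c = - 1" | "-1 < c" "c < 1"
    using c by linarith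
  then show ?thesis
  proof cases
    case 1
    then show ?thesis by (simp add: c_def)
  next
    case 2
    then have "(u + v) \<bullet> (u + v) = 0"
      using uu by (simp add: c_def algebra_simps inner_commute)
    then have "v = - u"
      by (simp add: add_eq_0_iff)
    moreover have "u \<noteq> 0"
      using u by auto
    ultimately show ?thesis
      using measure_separated_antipodal[of u] uu by simp
  next
    case 3
    define s where "s = sqrt (1 - c\<^sup>2)"
    have "c\<^sup>2 < 1"
      using 3 by (simp add: abs_square_less_1)
    then have s: "0 < s" "s\<^sup>2 = 1 - c\<^sup>2"
      by (auto simp: s_def)
    define b where "b = (1 / s) *\<^sub>R (v - c *\<^sub>R u)"
    have "(v - c *\<^sub>R u) \<bullet> (v - c *\<^sub>R u) = s\<^sup>2"
      unfolding s using uu by (simp add: c_def algebra_simps inner_commute power2_eq_square)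
    then have "b \<bullet> b = 1"
      using s(1) by (simp add: b_def power2_eq_square)
    then have b: "norm b = 1" "u \<bullet> b = 0"
      using uu by (auto simp: norm_eq_1 b_def c_def algebra_simps)
    have "circle_point u b (arccos c) = v"
      using 3 s by (simp add: circle_point_def sin_arccos b_def s_def)
    moreover have "0 \<le> arccos c" "arccos c < pi"
      using 3 arccos_lt_bounded[of c] by auto
    ultimately show ?thesis
      using measure_separated_angle_ge[OF u b, of "arccos c"] by (simp add: c_def)
  qed
qed

text \<open>\<open>p U\<close> is the share of normals that have exactly the vectors indexed by
  \<open>U\<close> on their positive side. The cells whose \<open>U\<close> contains just one of
  \<open>i\<close> and \<open>j\<close> add up to the set separating \<open>v i\<close> from
  \<open>v j\<close>.\<close>

lemma random_hyperplane_rounding: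
  fixes v :: "'i::finite \<Rightarrow> real^'n::{finite,wellorder}"
  assumes v: "\<And>i. norm (v i) = 1"
  obtains p :: "'i set \<Rightarrow> real" where "\<And>U. 0 \<le> p U" "(\<Sum>U\<in>UNIV. p U) = 1"
    "\<And>i j. arccos (v i \<bullet> v j) / pi \<le> (\<Sum>U | (i \<in> U) \<noteq> (j \<in> U). p U)"
proof
  let ?m = "measure lebesgue (ball (0::real^'n::_) 1)"
  have m: "0 < ?m"
    by (simp add: content_ball_pos)
  define p where "p U = measure lebesgue (half_ball_pattern v U) / ?m" for U
  have sum: "(\<Sum>U\<in>\<U>. p U) = measure lebesgue (\<Union>U\<in>\<U>. half_ball_pattern v U) / ?m" for \<U>
  proof -
    have "measure lebesgue (\<Union>U\<in>\<U>. half_ball_pattern v U)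
      = (\<Sum>U\<in>\<U>. measure lebesgue (half_ball_pattern v U))"
      by (intro measure_UNION' half_ball_pattern_lmeasurable)
        (auto simp: pairwise_def disjnt_def half_ball_pattern_def)
    then show ?thesis
      by (simp add: p_def sum_divide_distrib)
  qed
  show "0 \<le> p U" for U
    by (simp add: p_def)
  have "(\<Union>U\<in>UNIV. half_ball_pattern v U) = ball 0 1"
    by (auto simp: half_ball_pattern_def)
  then show "(\<Sum>U\<in>UNIV. p U) = 1"
    unfolding sum using m by simp
  show "arccos (v i \<bullet> v j) / pi \<le> (\<Sum>U | (i \<in> U) \<noteq> (j \<in> U). p U)" for i j
  proof -
    have "(\<Union>U\<in>{U. (i \<in> U) \<noteq> (j \<in> U)}. half_ball_pattern v U) = separated (v i) (v j)"
      by (intro set_eqI) (simp add: half_ball_pattern_def separated_def)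
    then have "(\<Sum>U | (i \<in> U) \<noteq> (j \<in> U). p U) = measure lebesgue (separated (v i) (v j)) / ?m"
      by (simp only: sum)
    moreover have "arccos (v i \<bullet> v j) / pi \<le> measure lebesgue (separated (v i) (v j)) / ?m"
      unfolding pos_le_divide_eq[OF m] by (rule measure_separated_ge[OF v v])
    ultimately show ?thesis
      by simp
  qed
qed

subsection \<open>The Goemans--Williamson constant\<close>

lemma one_minus_cos_le: "1 - cos x \<le> x\<^sup>2 / 2" for x :: real
proof -
  have "(sin (x / 2))\<^sup>2 \<le> (x / 2)\<^sup>2"
    by (rule abs_le_square_iff[THEN iffD1]) (rule abs_sin_x_le_abs_x)
  moreover have "1 - cos x = 2 * (sin (x / 2))\<^sup>2"
    using cos_double_sin[of "x / 2"] by simp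
  ultimately show ?thesis
    by (simp add: power2_eq_square)
qed

text \<open>The range of angles is not compact at zero, so the minimum is taken over
  \<open>{1..pi}\<close>. For angles below one the quotient is at least its value 1 at pi, since
  \<open>1 - cos \<theta>\<close> is at most quadratic.\<close>

lemma alpha_GW:
  shows alpha_GW_pos: "0 < alpha_GW" and alpha_GW_le_1: "alpha_GW \<le> 1"
    and alpha_GW_le: "\<And>\<theta>. 0 < \<theta> \<Longrightarrow> \<theta> \<le> pi \<Longrightarrow> alpha_GW * ((1 - cos \<theta>) / 2) \<le> \<theta> / pi"
proof -
  define f where "f \<theta> = (2 / pi) * (\<theta> / (1 - cos \<theta>))" for \<theta> :: real
  have cos_lt: "cos \<theta> < 1" if "0 < \<theta>" "\<theta> \<le> pi" for \<theta> :: real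
    using cos_monotone_0_pi[of 0 \<theta>] that by simp
  have f_pi: "f pi = 1"
    by (simp add: f_def)
  have "continuous_on {1..pi} f"
  proof -
    have "1 - cos \<theta> \<noteq> 0" if "\<theta> \<in> {1..pi}" for \<theta> :: real
      using cos_lt[of \<theta>] that by simp
    then show ?thesis
      unfolding f_def by (intro continuous_intros ballI)
  qed
  moreover have "compact {1..pi}" "{1..pi} \<noteq> {}"
    using pi_gt3 by auto
  ultimately obtain \<theta>0 where \<theta>0: "\<theta>0 \<in> {1..pi}" "\<And>\<theta>. \<theta> \<in> {1..pi} \<Longrightarrow> f \<theta>0 \<le> f \<theta>"
    using continuous_attains_inf by meson
  have small: "1 \<le> f \<theta>" if "0 < \<theta>" "\<theta> < 1" for \<theta>
  proof -
    have "pi * (1 - cos \<theta>) \<le> 4 * (\<theta>\<^sup>2 / 2)"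
      using one_minus_cos_le[of \<theta>] pi_less_4 that cos_le_one[of \<theta>] by (intro mult_mono) auto
    also have "\<dots> \<le> 2 * \<theta>"
      using that by (simp add: power2_eq_square)
    finally show ?thesis
      using cos_lt[of \<theta>] that pi_gt3 by (simp add: f_def pos_le_divide_eq)
  qed
  have min: "f \<theta>0 \<le> f \<theta>" if "0 < \<theta>" "\<theta> \<le> pi" for \<theta>
  proof (cases "\<theta> < 1")
    case True
    then show ?thesis
      using small[of \<theta>] \<theta>0(2)[of pi] f_pi that pi_gt3 by simp
  next
    case False
    then show ?thesis
      using \<theta>0(2) that by simp
  qed
  have \<alpha>: "alpha_GW = f \<theta>0"
    unfolding alpha_GW_def f_def[symmetric] using \<theta>0(1) min
    by (intro Least_equality) (auto intro!: exI[of _ \<theta>0])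
  show "0 < alpha_GW"
    unfolding \<alpha> f_def using \<theta>0(1) cos_lt[of \<theta>0] by simp
  show "alpha_GW \<le> 1"
    using min[of pi] f_pi \<alpha> by simp
  show "alpha_GW * ((1 - cos \<theta>) / 2) \<le> \<theta> / pi" if \<theta>: "0 < \<theta>" "\<theta> \<le> pi" for \<theta>
  proof -
    have pos: "0 < (1 - cos \<theta>) / 2"
      using cos_lt[OF \<theta>] by simp
    have "f \<theta> = (\<theta> / pi) / ((1 - cos \<theta>) / 2)"
      by (simp add: f_def)
    then have "alpha_GW \<le> (\<theta> / pi) / ((1 - cos \<theta>) / 2)"
      using min[OF \<theta>] \<alpha> by simp
    then show ?thesis
      by (simp only: pos_le_divide_eq[OF pos])
  qed
qed

subsection \<open>Positive semidefinite matrices and the elliptope\<close>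

lemma trace_inner_eq_inner: "trace_inner A B = A \<bullet> B"
  unfolding trace_inner_def trace_def matrix_matrix_mult_def transpose_def inner_vec_def
  by (simp add: inner_vec_def) (rule sum.swap)

text \<open>Makes a quadratic form linear in the matrix, as needed for closedness of the cone and
  for duality.\<close>

lemma inner_outer: "A \<bullet> outer x y = x \<bullet> (A *v y)"
  by (simp add: inner_vec_def outer_def matrix_vector_mult_def sum_distrib_left mult_ac)

lemma inner_mult_symmetric:
  fixes A :: "real^'n^'n"
  assumes "transpose A = A"
  shows "x \<bullet> (A *v y) = y \<bullet> (A *v x)"
  by (metis assms dot_lmul_matrix inner_commute transpose_matrix_vector)

lemma psd_symmetric: "psd A \<Longrightarrow> A $ i $ j = A $ j $ i"
  unfolding psd_def transpose_def by (metis (lifting) vec_lambda_beta)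

lemma outer_mult_vector: "outer x y *v z = (y \<bullet> z) *\<^sub>R x"
  by (simp add: vec_eq_iff outer_def matrix_vector_mult_def inner_vec_def sum_distrib_left
      sum_distrib_right mult_ac)

lemma psd_outer: "psd (outer x x)"
proof -
  have "y \<bullet> (outer x x *v y) = (x \<bullet> y)\<^sup>2" for y
    by (simp add: outer_mult_vector power2_eq_square inner_commute)
  moreover have "transpose (outer x x) = outer x x"
    by (simp add: transpose_def outer_def mult.commute)
  ultimately show ?thesis
    by (simp add: psd_def)
qed

lemma psd_add: "psd A \<Longrightarrow> psd B \<Longrightarrow> psd (A + B)"
  by (auto simp: psd_def transpose_def vec_eq_iff matrix_vector_mult_add_rdistrib inner_add_right)

lemma psd_scaleR: "psd A \<Longrightarrow> 0 \<le> c \<Longrightarrow> psd (c *\<^sub>R A)"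
  by (auto simp: psd_def transpose_def vec_eq_iff scaleR_matrix_vector_assoc[symmetric])

lemma psd_0: "psd 0"
  by (simp add: psd_def transpose_def vec_eq_iff)

lemma psd_mat_1: "psd (mat 1)"
  by (simp add: psd_def)

lemma psd_diag_nonneg:
  assumes "psd A"
  shows "0 \<le> A $ i $ i"
proof -
  have "0 \<le> axis i 1 \<bullet> (A *v axis i 1)"
    using assms by (simp add: psd_def)
  then show ?thesis
    by (simp add: inner_axis' matrix_vector_mult_basis column_def)
qed

lemma quadratic_form_axis_add_axis:
  "(axis i 1 + s *\<^sub>R axis j 1) \<bullet> (A *v (axis i 1 + s *\<^sub>R axis j 1))
    = A $ i $ i + s * (A $ i $ j + A $ j $ i) + s\<^sup>2 * A $ j $ j"
  by (simp add: matrix_vector_right_distrib matrix_vector_mult_scaleR matrix_vector_mult_basis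
      inner_add_left inner_add_right inner_axis' column_def power2_eq_square algebra_simps)

text \<open>The form is tested on the sum and on the difference of two axis vectors.\<close>

lemma psd_entry_bound:
  assumes "psd A"
  shows "2 * \<bar>A $ i $ j\<bar> \<le> A $ i $ i + A $ j $ j"
proof -
  have "0 \<le> A $ i $ i + s * (A $ i $ j + A $ j $ i) + s\<^sup>2 * A $ j $ j" for s
    unfolding quadratic_form_axis_add_axis[symmetric] using assms by (simp add: psd_def)
  from this[of 1] this[of "-1"] show ?thesis
    using psd_symmetric[OF assms, of i j] by simp
qed

text \<open>One step of Cholesky elimination with pivot \<open>k\<close>. The last claim ensures
  that zeros already on the diagonal survive.\<close>

lemma psd_eliminate:
  assumes A: "psd A" and k: "A $ k $ k \<noteq> 0"
  defines "B \<equiv> A - (1 / A $ k $ k) *\<^sub>R outer (column k A) (column k A)"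
  shows "psd B" "B $ k $ k = 0" "A $ i $ i = 0 \<Longrightarrow> B $ i $ i = 0"
proof -
  define d where "d = A $ k $ k"
  have d: "0 < d"
    using psd_diag_nonneg[OF A, of k] k by (simp add: d_def)
  have sym: "transpose A = A"
    using A by (simp add: psd_def)
  have "0 \<le> x \<bullet> (B *v x)" for x
  proof -
    define c where "c = column k A \<bullet> x"
    \<comment> \<open>\<open>y\<close> minimises the form of \<open>A\<close> on the line through
      \<open>x\<close> in direction \<open>axis k 1\<close>; completing the square shows that the
      minimum is the form of \<open>B\<close> at \<open>x\<close>.\<close>
    define y where "y = x - (c / d) *\<^sub>R axis k 1"
    have kx: "axis k 1 \<bullet> (A *v x) = c"
      unfolding inner_mult_symmetric[OF sym, of "axis k 1" x]
      by (simp add: matrix_vector_mult_basis c_def inner_commute)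
    have xk: "x \<bullet> (A *v axis k 1) = c"
      by (simp add: matrix_vector_mult_basis c_def inner_commute)
    have kk: "axis k 1 \<bullet> (A *v axis k 1) = d"
      by (simp add: inner_axis' matrix_vector_mult_basis column_def d_def)
    have "0 \<le> y \<bullet> (A *v y)"
      using A by (simp add: psd_def)
    also have "y \<bullet> (A *v y) = x \<bullet> (A *v x) - c\<^sup>2 / d"
      using d by (simp add: y_def matrix_vector_mult_diff_distrib matrix_vector_mult_scaleR
          inner_diff_left inner_diff_right kx xk kk power2_eq_square)
    also have "\<dots> = x \<bullet> (B *v x)"
      by (simp add: B_def matrix_vector_mult_diff_rdistrib inner_diff_right d_def
          scaleR_matrix_vector_assoc[symmetric] outer_mult_vector c_def power2_eq_square inner_commute)
    finally show ?thesis .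
  qed
  moreover have "transpose B = B"
    using psd_symmetric[OF A]
    by (simp add: B_def transpose_def vec_eq_iff outer_def mult.commute)
  ultimately show "psd B"
    by (simp add: psd_def)
  show "B $ k $ k = 0"
    using k by (simp add: B_def outer_def column_def)
  assume i: "A $ i $ i = 0"
  have "0 \<le> B $ i $ i"
    using \<open>psd B\<close> by (rule psd_diag_nonneg)
  moreover have "B $ i $ i = - ((A $ i $ k)\<^sup>2 / d)"
    using i by (simp add: B_def outer_def column_def d_def power2_eq_square)
  moreover have "0 \<le> (A $ i $ k)\<^sup>2 / d"
    using d by simp
  ultimately show "B $ i $ i = 0"
    by linarith
qed

text \<open>Induction over a set outside which the diagonal vanishes: each nonzero pivot is
  eliminated by one outer product, a zero pivot contributes the zero vector. With a zero diagonal,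
  the entry bound leaves only the zero matrix.\<close>

lemma psd_sum_outer:
  fixes A :: "real^'v::finite^'v"
  assumes "psd A"
  obtains c :: "'v \<Rightarrow> real^'v" where "A = (\<Sum>k\<in>UNIV. outer (c k) (c k))"
proof -
  have "\<exists>c. A = (\<Sum>k\<in>S. outer (c k) (c k))"
    if "finite S" "psd A" "\<And>i. i \<notin> S \<Longrightarrow> A $ i $ i = 0" for S and A :: "real^'v^'v"
    using that
  proof (induction S arbitrary: A rule: finite_induct)
    case empty
    then have "2 * \<bar>A $ i $ j\<bar> \<le> 0" for i j
      using psd_entry_bound[of A i j] by simp
    then have "A = 0"
      by (simp add: vec_eq_iff)
    then show ?case by simp
  next
    case (insert k S)
    have "\<exists>c b. A = outer b b + (\<Sum>k\<in>S. outer (c k) (c k))"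
    proof (cases "A $ k $ k = 0")
      case True
      then obtain c where "A = (\<Sum>k\<in>S. outer (c k) (c k))"
        using insert by (metis insertE)
      moreover have "outer 0 0 = (0 :: real^'v^'v)"
        by (simp add: outer_def vec_eq_iff)
      ultimately show ?thesis
        by (metis add_0)
    next
      case False
      let ?o = "(1 / A $ k $ k) *\<^sub>R outer (column k A) (column k A)"
      note B = psd_eliminate[OF \<open>psd A\<close> False]
      have "\<exists>c. A - ?o = (\<Sum>k\<in>S. outer (c k) (c k))"
        using B insert.prems(2) by (intro insert.IH) (metis insertE)+
      then obtain c where "A = ?o + (\<Sum>k\<in>S. outer (c k) (c k))"
        by (metis add.commute diff_add_cancel)
      moreover define b where "b = (1 / sqrt (A $ k $ k)) *\<^sub>R column k A"
      have "?o = outer b b"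
        using psd_diag_nonneg[OF \<open>psd A\<close>, of k] by (simp add: b_def outer_def vec_eq_iff)
      ultimately have "A = outer b b + (\<Sum>k\<in>S. outer (c k) (c k))"
        by simp
      then show ?thesis
        by blast
    qed
    then obtain c b where "A = outer b b + (\<Sum>k\<in>S. outer (c k) (c k))"
      by blast
    moreover have "(\<Sum>j\<in>S. outer ((c(k := b)) j) ((c(k := b)) j)) = (\<Sum>k\<in>S. outer (c k) (c k))"
      using insert.hyps by (intro sum.cong) auto
    ultimately have "A = (\<Sum>j\<in>insert k S. outer ((c(k := b)) j) ((c(k := b)) j))"
      using insert.hyps by simp
    then show ?case by blast
  qed
  from this[of UNIV A] assms that show ?thesis
    by auto
qed

text \<open>The index type \<^typ>\<open>'v bit0\<close> is large enough for a Gram representation and is of class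
  \<^class>\<open>wellorder\<close>, which the change-of-variables theorems for Lebesgue measure require.\<close>

lemma psd_gram:
  fixes A :: "real^'v::finite^'v"
  assumes "psd A"
  obtains v :: "'v \<Rightarrow> real^'v bit0" where "\<And>i j. A $ i $ j = v i \<bullet> v j"
proof -
  obtain c :: "'v \<Rightarrow> real^'v" where A: "A = (\<Sum>k\<in>UNIV. outer (c k) (c k))"
    using psd_sum_outer[OF assms] .
  obtain f :: "'v \<Rightarrow> 'v bit0" where f: "inj f"
    using card_le_inj[of "UNIV :: 'v set" "UNIV :: 'v bit0 set"] by auto
  \<comment> \<open>The \<open>c k\<close> are the columns of a factor of \<open>A\<close>, and
    \<open>v i\<close> is its row \<open>i\<close>, padded with zeros outside
    \<open>range f\<close>.\<close>
  define v where "v i = (\<chi> k. if k \<in> range f then c (inv f k) $ i else 0)" for i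
  have "v i \<bullet> v j = A $ i $ j" for i j
  proof -
    have "v i \<bullet> v j = (\<Sum>k\<in>range f. v i $ k * v j $ k)"
      unfolding inner_vec_def by (rule sum.mono_neutral_cong_right) (auto simp: v_def)
    also have "\<dots> = (\<Sum>k\<in>UNIV. c k $ i * c k $ j)"
      by (subst sum.reindex[OF f]) (simp add: v_def f)
    finally show ?thesis
      by (simp add: A outer_def)
  qed
  then show ?thesis
    using that[of v] by simp
qed

lemma elliptope_rounding:
  fixes Y :: "real^'v::finite^'v"
  assumes "psd Y" "\<And>i. Y $ i $ i = 1"
  obtains p :: "'v set \<Rightarrow> real" where "\<And>U. 0 \<le> p U" "(\<Sum>U\<in>UNIV. p U) = 1"
    "\<And>i j. arccos (Y $ i $ j) / pi \<le> (\<Sum>U | (i \<in> U) \<noteq> (j \<in> U). p U)"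
proof -
  obtain v :: "'v \<Rightarrow> real^'v bit0" where v: "\<And>i j. Y $ i $ j = v i \<bullet> v j"
    using psd_gram[OF assms(1)] by blast
  have "norm (v i) = 1" for i
    using assms(2)[of i] v[of i i] by (simp add: norm_eq_1)
  from random_hyperplane_rounding[of v, OF this] that show ?thesis
    unfolding v by blast
qed

section \<open>Attainment and strong duality over the elliptope\<close>

lemma compact_elliptope: "compact {Y :: real^'v::finite^'v. psd Y \<and> (\<forall>i. Y $ i $ i = 1)}"
proof -
  \<comment> \<open>All conditions become linear equations and inequalities in \<open>Y\<close>, so
    closedness is immediate.\<close>
  have psd_iff: "psd Y \<longleftrightarrow> (\<forall>i j. Y $ i $ j = Y $ j $ i) \<and> (\<forall>x. 0 \<le> Y \<bullet> outer x x)"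
    for Y :: "real^'v^'v"
    unfolding psd_def inner_outer by (auto simp: transpose_def vec_eq_iff)
  have "closed {Y :: real^'v^'v. psd Y \<and> (\<forall>i. Y $ i $ i = 1)}"
    unfolding psd_iff
    by (intro closed_Collect_conj closed_Collect_all closed_Collect_eq closed_Collect_le
        continuous_intros)
  moreover have "bounded {Y :: real^'v^'v. psd Y \<and> (\<forall>i. Y $ i $ i = 1)}"
  proof (rule boundedI)
    fix Y :: "real^'v^'v"
    assume "Y \<in> {Y. psd Y \<and> (\<forall>i. Y $ i $ i = 1)}"
    then have le: "\<bar>Y $ i $ j\<bar> \<le> 1" for i j
      using psd_entry_bound[of Y i j] by auto
    have "norm Y \<le> (\<Sum>i\<in>UNIV. norm (Y $ i))"
      unfolding norm_vec_def by (rule L2_set_le_sum) simp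
    also have "\<dots> \<le> (\<Sum>i\<in>UNIV. \<Sum>j\<in>UNIV. \<bar>Y $ i $ j\<bar>)"
      by (intro sum_mono norm_le_l1_cart)
    also have "\<dots> \<le> (\<Sum>i\<in>(UNIV::'v set). \<Sum>j\<in>(UNIV::'v set). 1)"
      by (intro sum_mono le)
    finally show "norm Y \<le> (\<Sum>i\<in>(UNIV::'v set). \<Sum>j\<in>(UNIV::'v set). 1)" .
  qed
  ultimately show ?thesis
    by (simp add: compact_eq_bounded_closed)
qed

lemma elliptope_attains_max:
  fixes C :: "real^'v::finite^'v"
  obtains Y where "psd Y" "\<And>i. Y $ i $ i = 1"
    "\<And>Z. psd Z \<Longrightarrow> (\<And>i. Z $ i $ i = 1) \<Longrightarrow> C \<bullet> Z \<le> C \<bullet> Y"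
proof -
  have "continuous_on {Y :: real^'v^'v. psd Y \<and> (\<forall>i. Y $ i $ i = 1)} (\<lambda>Y. C \<bullet> Y)"
    by (intro continuous_intros)
  moreover have "mat 1 \<in> {Y :: real^'v^'v. psd Y \<and> (\<forall>i. Y $ i $ i = 1)}"
    by (simp add: psd_mat_1) (simp add: mat_def)
  ultimately obtain Y where "Y \<in> {Y :: real^'v^'v. psd Y \<and> (\<forall>i. Y $ i $ i = 1)}"
    "\<forall>Z\<in>{Y :: real^'v^'v. psd Y \<and> (\<forall>i. Y $ i $ i = 1)}. C \<bullet> Z \<le> C \<bullet> Y"
    using continuous_attains_sup[OF compact_elliptope] by blast
  then show ?thesis
    by (intro that[of Y]) auto
qed

text \<open>Strong duality: the cone of all pairs (diagonal of \<open>Y\<close>, value of \<open>Y\<close>) is separated from the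
  open ray above the optimal pair; Slater's condition makes the multiplier of the value nonzero.\<close>

lemma elliptope_dual:
  fixes C :: "real^'v::finite^'v"
  assumes max: "\<And>Z. psd Z \<Longrightarrow> (\<And>i. Z $ i $ i = 1) \<Longrightarrow> C \<bullet> Z \<le> \<rho>"
  obtains x :: "real^'v" where "(\<Sum>i\<in>UNIV. x $ i) \<le> \<rho>"
    "\<And>Z. psd Z \<Longrightarrow> C \<bullet> Z \<le> (\<Sum>i\<in>UNIV. x $ i * Z $ i $ i)"
proof -
  define diag where "diag Z = (\<chi> i. Z $ i $ i)" for Z :: "real^'v^'v"
  let ?one = "(\<chi> i. 1) :: real^'v"
  define S where "S = (\<lambda>Z. (diag Z, C \<bullet> Z)) ` {Z. psd Z}"
  define T where "T = {?one} \<times> {\<rho><..}"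
  have "linear (\<lambda>Z. (diag Z, C \<bullet> Z))"
    by (rule linearI) (auto simp: diag_def vec_eq_iff inner_add_right)
  moreover have "convex {Z :: real^'v^'v. psd Z}"
    by (auto simp: convex_def intro!: psd_add psd_scaleR)
  ultimately have "convex S"
    unfolding S_def by (rule convex_linear_image)
  moreover have "convex T"
    unfolding T_def by (intro convex_Times) auto
  moreover have "S \<noteq> {}" "T \<noteq> {}"
    using psd_0 by (auto simp: S_def T_def)
  moreover have "S \<inter> T = {}"
    using max by (force simp: S_def T_def diag_def vec_eq_iff)
  ultimately obtain n b where n: "n \<noteq> 0" "\<forall>s\<in>S. n \<bullet> s \<le> b" "\<forall>s\<in>T. b \<le> n \<bullet> s"
    using separating_hyperplane_sets by metis
  obtain a t where "n = (a, t)"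
    by fastforce
  then have at0: "a \<noteq> 0 \<or> t \<noteq> 0" and S: "\<And>Z. psd Z \<Longrightarrow> a \<bullet> diag Z + t * (C \<bullet> Z) \<le> b"
    and T: "\<And>s. \<rho> < s \<Longrightarrow> b \<le> a \<bullet> ?one + t * s"
    using n by (auto simp: S_def T_def zero_prod_def)
  have b: "0 \<le> b"
    using S[OF psd_0] by (simp add: diag_def inner_vec_def)
  have cone: "a \<bullet> diag Z + t * (C \<bullet> Z) \<le> 0" if Z: "psd Z" for Z
  proof (rule ccontr)
    define h where "h = a \<bullet> diag Z + t * (C \<bullet> Z)"
    assume "\<not> ?thesis"
    then have h: "0 < h"
      by (simp add: h_def)
    \<comment> \<open>A positive value \<open>h\<close> could be scaled up to \<open>b + 1\<close>,
      past the bound \<open>b\<close> on the cone.\<close>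
    define c where "c = (b + 1) / h"
    have "diag (c *\<^sub>R Z) = c *\<^sub>R diag Z"
      by (simp add: diag_def vec_eq_iff)
    then have "a \<bullet> diag (c *\<^sub>R Z) + t * (C \<bullet> (c *\<^sub>R Z)) = c * h"
      by (simp add: h_def algebra_simps)
    moreover have "0 \<le> c" "c * h = b + 1"
      using h b by (auto simp: c_def)
    ultimately show False
      using S[OF psd_scaleR[OF Z, of c]] by linarith
  qed
  have t: "0 \<le> t"
  proof (rule ccontr)
    assume t: "\<not> 0 \<le> t"
    \<comment> \<open>High enough on the ray to make the functional at most -1 if \<open>t\<close>
      is negative, contradicting \<open>0 \<le> b\<close>.\<close>
    define s where "s = max (\<rho> + 1) ((a \<bullet> ?one + 1) / - t)"
    have "a \<bullet> ?one + 1 \<le> s * - t"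
      using t by (subst pos_divide_le_eq[symmetric]) (auto simp: s_def)
    moreover have "b \<le> a \<bullet> ?one + t * s"
      by (rule T) (simp add: s_def)
    ultimately show False
      using b by (simp add: mult.commute)
  qed
  have le: "0 \<le> a \<bullet> ?one + t * \<rho>"
  proof (rule field_le_epsilon)
    fix e :: real assume e: "0 < e"
    \<comment> \<open>This approaches the end of the ray; the divisor \<open>t + 1\<close> stays
      positive even though \<open>t\<close> may still be zero.\<close>
    have "b \<le> a \<bullet> ?one + t * (\<rho> + e / (t + 1))"
      using e t by (intro T) simp
    moreover have "t * (e / (t + 1)) \<le> e"
      using e t by (simp add: field_simps)
    ultimately show "0 \<le> a \<bullet> ?one + t * \<rho> + e"
      using b by (simp add: algebra_simps)
  qed
  have "t \<noteq> 0"
  proof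
    assume "t = 0"
    \<comment> \<open>If \<open>t\<close> were zero, rank-one matrices on the axes would make all
      entries of \<open>a\<close> nonpositive while \<open>le\<close> makes their sum nonnegative,
      so \<open>a\<close> would vanish too.\<close>
    have a_le: "a $ i \<le> 0" for i
    proof -
      have "diag (outer (axis i 1) (axis i 1)) = axis i 1"
        by (simp add: diag_def outer_def vec_eq_iff axis_def)
      then show ?thesis
        using cone[OF psd_outer, of "axis i 1"] \<open>t = 0\<close> by (simp add: inner_axis)
    qed
    moreover have "0 \<le> (\<Sum>i\<in>UNIV. a $ i)"
      using le \<open>t = 0\<close> by (simp add: inner_vec_def)
    ultimately have "(\<Sum>i\<in>UNIV. - (a $ i)) = 0"
      using sum_nonpos[of UNIV "\<lambda>i. a $ i"] by (simp add: sum_negf)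
    then have "\<forall>i\<in>UNIV. - (a $ i) = 0"
      using a_le by (subst (asm) sum_nonneg_eq_0_iff) auto
    then show False
      using at0 \<open>t = 0\<close> by (simp add: vec_eq_iff)
  qed
  with t have t: "0 < t"
    by simp
  \<comment> \<open>Dividing by \<open>t\<close> normalises the multiplier of the objective to
    one.\<close>
  define x where "x = - (1 / t) *\<^sub>R a"
  show ?thesis
  proof
    have "(\<Sum>i\<in>UNIV. x $ i) = - (a \<bullet> ?one) / t"
      by (simp add: x_def inner_vec_def sum_negf sum_divide_distrib)
    also have "\<dots> \<le> \<rho>"
      unfolding pos_divide_le_eq[OF t] using le by (simp add: mult.commute)
    finally show "(\<Sum>i\<in>UNIV. x $ i) \<le> \<rho>" .
  next
    fix Z :: "real^'v^'v" assume Z: "psd Z"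
    have "C \<bullet> Z \<le> - (a \<bullet> diag Z) / t"
      unfolding pos_le_divide_eq[OF t] using cone[OF Z] by (simp add: mult.commute)
    also have "\<dots> = (\<Sum>i\<in>UNIV. x $ i * Z $ i $ i)"
      by (simp add: x_def inner_vec_def sum_negf sum_divide_distrib diag_def)
    finally show "C \<bullet> Z \<le> (\<Sum>i\<in>UNIV. x $ i * Z $ i $ i)" .
  qed
qed

subsection \<open>Graphs and certificates\<close>

text \<open>A quarter of the adjoint Laplacian as a function of the edge as a set, independent of an
  order of its endpoints. The factor 2 makes up for the diagonal entries in the double sum.\<close>

definition edge_form :: "real^'v^'v::finite \<Rightarrow> 'v set \<Rightarrow> real" where
  "edge_form Y e = (1/4) * (2 * (\<Sum>i\<in>e. Y $ i $ i) - (\<Sum>i\<in>e. \<Sum>j\<in>e. Y $ i $ j))"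

lemma edge_form_doubleton:
  "i \<noteq> j \<Longrightarrow> edge_form Y {i, j} = (1/4) * laplacian_adj Y i j"
  by (simp add: edge_form_def laplacian_adj_def)

lemma edge_form_elliptope:
  assumes "psd Y" "\<And>i. Y $ i $ i = 1" "i \<noteq> j"
  shows "edge_form Y {i, j} = (1 - Y $ i $ j) / 2"
  using assms psd_symmetric[OF assms(1), of i j]
  by (simp add: edge_form_doubleton laplacian_adj_def)

lemma simple_graph_edgeE:
  assumes "simple_graph E" "e \<in> E"
  obtains i j where "e = {i, j}" "i \<noteq> j"
  using assms by (auto simp: simple_graph_def card_2_iff)

text \<open>The endpoints of an edge are distinct, so exactly two ordered pairs yield it.\<close>

lemma sum_ordered_pairs_edges:
  fixes f :: "'v::finite set \<Rightarrow> real"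
  assumes E: "simple_graph E"
  shows "(\<Sum>(i, j) | {i, j} \<in> E. f {i, j}) = 2 * (\<Sum>e\<in>E. f e)"
proof -
  let ?P = "{(i, j). {i, j} \<in> E}" and ?g = "\<lambda>(i, j). {i, j}"
  have "(\<Sum>(i, j) | {i, j} \<in> E. f {i, j}) = (\<Sum>e\<in>E. \<Sum>p\<in>{p \<in> ?P. ?g p = e}. f (?g p))"
    by (subst sum.group) (auto simp: case_prod_beta)
  also have "\<dots> = (\<Sum>e\<in>E. 2 * f e)"
  proof (rule sum.cong)
    fix e assume e: "e \<in> E"
    obtain i j where ij: "e = {i, j}" "i \<noteq> j"
      using simple_graph_edgeE[OF E e] .
    then have "{p \<in> ?P. ?g p = e} = {(i, j), (j, i)}"
      using e by (auto simp: doubleton_eq_iff insert_commute[of j i])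
    then show "(\<Sum>p\<in>{p \<in> ?P. ?g p = e}. f (?g p)) = 2 * f e"
      using ij by (simp add: insert_commute)
  qed simp
  finally show ?thesis
    by (simp add: sum_distrib_left)
qed

text \<open>Adjointness: each outer product paired with \<open>Y\<close> gives
  \<open>laplacian_adj\<close>, and the factor \<open>1/2\<close> cancels the double counting of
  edges.\<close>

lemma laplacian_inner:
  assumes E: "simple_graph E"
  shows "((1/4) *\<^sub>R laplacian E w) \<bullet> Y = (\<Sum>e\<in>E. w e * edge_form Y e)"
proof -
  have form: "outer (axis i 1 - axis j 1) (axis i 1 - axis j 1) \<bullet> Y = laplacian_adj Y i j" for i j
    unfolding inner_commute[of _ Y] inner_outer laplacian_adj_def
    by (simp add: matrix_vector_mult_diff_distrib matrix_vector_mult_basis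
        inner_diff_left inner_diff_right inner_axis' column_def)
  have "laplacian E w \<bullet> Y = (1/2) * (\<Sum>(i, j) | {i, j} \<in> E. w {i, j} * laplacian_adj Y i j)"
    by (simp add: laplacian_def inner_sum_left case_prod_beta form)
  also have "(\<Sum>(i, j) | {i, j} \<in> E. w {i, j} * laplacian_adj Y i j)
    = (\<Sum>(i, j) | {i, j} \<in> E. w {i, j} * (4 * edge_form Y {i, j}))"
  proof (intro sum.cong refl)
    fix p :: "'a \<times> 'a" assume "p \<in> {(i, j). {i, j} \<in> E}"
    then obtain i j where p: "p = (i, j)" "{i, j} \<in> E"
      by auto
    then have "card {i, j} = 2"
      using E by (simp add: simple_graph_def)
    then have "i \<noteq> j"
      by auto
    then show "(case p of (i, j) \<Rightarrow> w {i, j} * laplacian_adj Y i j)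
      = (case p of (i, j) \<Rightarrow> w {i, j} * (4 * edge_form Y {i, j}))"
      by (simp add: p(1) edge_form_doubleton)
  qed
  also have "\<dots> = 2 * (\<Sum>e\<in>E. w e * (4 * edge_form Y e))"
    using sum_ordered_pairs_edges[OF E, of "\<lambda>e. w e * (4 * edge_form Y e)"] .
  finally show ?thesis
    by (simp add: sum_distrib_left mult_ac)
qed

lemma laplacian_symmetric: "laplacian E w $ i $ j = laplacian E w $ j $ i"
  by (simp add: laplacian_def outer_def case_prod_beta mult_ac)

text \<open>Applying the dual inequality to the rank-one matrices \<open>outer v v\<close> recovers
  the quadratic form.\<close>

lemma psd_Diag_minus_laplacian:
  assumes "\<And>Z. psd Z \<Longrightarrow> ((1/4) *\<^sub>R laplacian E w) \<bullet> Z \<le> (\<Sum>i\<in>UNIV. x $ i * Z $ i $ i)"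
  shows "psd (Diag x - (1/4) *\<^sub>R laplacian E w)"
  unfolding psd_def
proof
  show "transpose (Diag x - (1/4) *\<^sub>R laplacian E w) = Diag x - (1/4) *\<^sub>R laplacian E w"
    using laplacian_symmetric[of E w] by (auto simp: transpose_def Diag_def vec_eq_iff)
  have "Diag x \<bullet> Z = (\<Sum>i\<in>UNIV. x $ i * Z $ i $ i)" for Z
    by (simp add: Diag_def inner_vec_def if_distrib[of "\<lambda>a. a * _"] cong: if_cong)
  then show "\<forall>v. 0 \<le> v \<bullet> ((Diag x - (1/4) *\<^sub>R laplacian E w) *v v)"
    using assms[OF psd_outer] by (simp add: inner_outer[symmetric] inner_diff_left)
qed

lemma sum_cut_indicator:
  assumes "{i, j} \<in> E" "i \<noteq> j"
  shows "(\<Sum>U\<in>UNIV. p U * indicator (cut E U) {i, j}) = (\<Sum>U | (i \<in> U) \<noteq> (j \<in> U). p U :: real)"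
proof -
  have "{i, j} \<in> cut E U \<longleftrightarrow> (i \<in> U) \<noteq> (j \<in> U)" for U
    using assms by (cases "i \<in> U"; cases "j \<in> U") (auto simp: cut_def Int_insert_left)
  then show ?thesis
    by (simp add: indicator_def of_bool_def if_distrib sum.If_cases cong: if_cong)
qed

text \<open>Here the angle is \<open>arccos c\<close>. The case \<open>c = 1\<close> gives the
  excluded angle zero, where both sides vanish.\<close>

lemma alpha_GW_elliptope:
  assumes "\<bar>c\<bar> \<le> 1"
  shows "alpha_GW * ((1 - c) / 2) \<le> arccos c / pi"
proof (cases "c = 1")
  case False
  then have "0 < arccos c" "arccos c \<le> pi" "cos (arccos c) = c"
    using assms arccos_less_arccos[of c 1] by (auto simp: arccos_ubound)
  then show ?thesis
    using alpha_GW_le[of "arccos c"] by simp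
qed simp

theorem theorem19:
  fixes E :: "'v::finite set set" and w :: "'v set \<Rightarrow> real"
  assumes "simple_graph E" and "nonneg_on E w" and "\<not> zero_on E w"
  shows "\<exists>z \<in> Z_set E w. \<not> zero_on E z \<and>
    (\<exists>\<rho> \<mu> S y x. is_certificate alpha_GW E w z (\<rho>, \<mu>, S, y, x))"
proof -
  let ?C = "(1/4) *\<^sub>R laplacian E w"
  have w: "0 \<le> w e" if "e \<in> E" for e
    using assms(2) that by (simp add: nonneg_on_def)
  note C = laplacian_inner[OF assms(1), of w]
  obtain Y where Y: "psd Y" "\<And>i. Y $ i $ i = 1"
    and max: "\<And>Z. psd Z \<Longrightarrow> (\<And>i. Z $ i $ i = 1) \<Longrightarrow> ?C \<bullet> Z \<le> ?C \<bullet> Y"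
    using elliptope_attains_max[where C = ?C] by blast
  define \<rho> where "\<rho> = ?C \<bullet> Y"
  define z where "z = edge_form Y"
  obtain x where x: "(\<Sum>i\<in>UNIV. x $ i) \<le> \<rho>"
    "\<And>Z. psd Z \<Longrightarrow> ?C \<bullet> Z \<le> (\<Sum>i\<in>UNIV. x $ i * Z $ i $ i)"
    using elliptope_dual[of ?C \<rho>] max unfolding \<rho>_def by blast
  have wz: "(\<Sum>e\<in>E. w e * z e) = \<rho>"
    by (simp only: \<rho>_def z_def C)
  have GW: "GW E w = \<rho>"
    unfolding GW_def trace_inner_eq_inner \<rho>_def
    by (rule Greatest_equality) (use Y max in auto)
  have Y_abs: "\<bar>Y $ i $ j\<bar> \<le> 1" for i j
    using psd_entry_bound[OF Y(1), of i j] Y(2) by simp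
  have z_edge: "z {i, j} = (1 - Y $ i $ j) / 2" if "i \<noteq> j" for i j
    unfolding z_def by (rule edge_form_elliptope[OF Y that])
  have z_nonneg: "0 \<le> z e" if e: "e \<in> E" for e
  proof -
    obtain i j where "e = {i, j}" "i \<noteq> j"
      using simple_graph_edgeE[OF assms(1) e] .
    then show ?thesis
      using z_edge[of i j] Y_abs[of i j] by simp
  qed
  \<comment> \<open>The identity matrix is feasible and attains half the total weight, which is
    positive as \<open>w\<close> is nonzero.\<close>
  have \<rho>_pos: "0 < \<rho>"
  proof -
    have diag1: "(mat 1 :: real^'v^'v) $ i $ i = 1" for i
      by (simp add: mat_def)
    have "edge_form (mat 1) e = 1 / 2" if e: "e \<in> E" for e
    proof -
      obtain i j where "e = {i, j}" "i \<noteq> j"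
        using simple_graph_edgeE[OF assms(1) e] .
      then show ?thesis
        using edge_form_elliptope[OF psd_mat_1 diag1, of i j] by (simp add: mat_def)
    qed
    then have "?C \<bullet> mat 1 = (\<Sum>e\<in>E. w e) / 2"
      unfolding C sum_divide_distrib by (intro sum.cong) simp_all
    moreover have "0 < (\<Sum>e\<in>E. w e)"
    proof -
      obtain e where "e \<in> E" "w e \<noteq> 0"
        using assms(3) by (auto simp: zero_on_def)
      then show ?thesis
        using w by (intro sum_pos2[of E e]) (auto simp: less_le)
    qed
    ultimately show ?thesis
      using max[OF psd_mat_1 diag1] by (simp add: \<rho>_def)
  qed
  have polar: "GW_polar E z = 1"
    unfolding GW_polar_def
  proof (rule Least_equality)
    have "z {i, j} \<le> (1/4) * laplacian_adj Y i j" if "{i, j} \<in> E" for i j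
    proof -
      have "card {i, j} = 2"
        using assms(1) that by (simp add: simple_graph_def)
      then have "i \<noteq> j"
        by auto
      then show ?thesis
        by (simp add: z_def edge_form_doubleton)
    qed
    then show "0 \<le> (1::real) \<and> (\<exists>Y. psd Y \<and> (\<forall>i. Y $ i $ i = 1) \<and>
        (\<forall>i j. {i, j} \<in> E \<longrightarrow> z {i, j} \<le> (1/4) * laplacian_adj Y i j))"
      using Y by auto
  next
    fix \<mu> :: real
    assume "0 \<le> \<mu> \<and> (\<exists>Y. psd Y \<and> (\<forall>i. Y $ i $ i = \<mu>) \<and>
        (\<forall>i j. {i, j} \<in> E \<longrightarrow> z {i, j} \<le> (1/4) * laplacian_adj Y i j))"
    then obtain Z where Z: "0 \<le> \<mu>" "psd Z" "\<And>i. Z $ i $ i = \<mu>"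
      "\<And>i j. {i, j} \<in> E \<Longrightarrow> z {i, j} \<le> (1/4) * laplacian_adj Z i j"
      by blast
    have "z e \<le> edge_form Z e" if e: "e \<in> E" for e
    proof -
      obtain i j where "e = {i, j}" "i \<noteq> j"
        using simple_graph_edgeE[OF assms(1) e] .
      then show ?thesis
        using Z(4)[of i j] e by (simp add: edge_form_doubleton)
    qed
    \<comment> \<open>Weak duality: the value of \<open>Z\<close> is at least \<open>\<rho>\<close>,
      since \<open>Z\<close> dominates \<open>z\<close>, and at most \<open>\<rho> * \<mu>\<close>,
      by the dual solution \<open>x\<close>.\<close>
    then have "\<rho> \<le> ?C \<bullet> Z"
      unfolding C wz[symmetric] using w by (intro sum_mono mult_left_mono) auto
    also have "\<dots> \<le> (\<Sum>i\<in>UNIV. x $ i * \<mu>)"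
      using x(2)[OF Z(2)] Z(3) by simp
    also have "\<dots> \<le> \<rho> * \<mu>"
      unfolding sum_distrib_right[symmetric] by (intro mult_right_mono x(1) Z(1))
    finally show "1 \<le> \<mu>"
      using \<rho>_pos by simp
  qed
  obtain p where p: "\<And>U. 0 \<le> p U" "(\<Sum>U\<in>UNIV. p U) = 1"
    "\<And>i j. arccos (Y $ i $ j) / pi \<le> (\<Sum>U | (i \<in> U) \<noteq> (j \<in> U). p U)"
    using elliptope_rounding[OF Y] by blast
  have p_cut: "alpha_GW * z e \<le> (\<Sum>U\<in>UNIV. p U * indicator (cut E U) e)" if e: "e \<in> E" for e
  proof -
    obtain i j where ij: "e = {i, j}" "i \<noteq> j"
      using simple_graph_edgeE[OF assms(1) e] .
    have "alpha_GW * z e \<le> arccos (Y $ i $ j) / pi"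
      unfolding ij(1) z_edge[OF ij(2)] by (rule alpha_GW_elliptope[OF Y_abs])
    also have "\<dots> \<le> (\<Sum>U | (i \<in> U) \<noteq> (j \<in> U). p U)"
      by (rule p(3))
    also have "\<dots> = (\<Sum>U\<in>UNIV. p U * indicator (cut E U) e)"
      using sum_cut_indicator[of i j E p] e ij by simp
    finally show ?thesis .
  qed
  define c where "c U = (\<Sum>e\<in>E. w e * indicator (cut E U) e)" for U
  have "Max (range c) \<in> range c"
    by (rule Max_in) auto
  then obtain S where "Max (range c) = c S"
    by (rule imageE)
  then have S: "c U \<le> c S" for U
    by (metis Max_ge finite finite_imageI rangeI)
  \<comment> \<open>Averaging: exchanging the sums turns the edgewise bounds into the expected
    weight of a random cut, which the best cut \<open>S\<close> dominates.\<close>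
  have "alpha_GW * \<rho> = (\<Sum>e\<in>E. w e * (alpha_GW * z e))"
    unfolding wz[symmetric] sum_distrib_left by (simp add: mult_ac)
  also have "\<dots> \<le> (\<Sum>e\<in>E. w e * (\<Sum>U\<in>UNIV. p U * indicator (cut E U) e))"
    by (intro sum_mono mult_left_mono p_cut w)
  also have "\<dots> = (\<Sum>U\<in>UNIV. p U * c U)"
    unfolding c_def sum_distrib_left by (subst sum.swap) (simp add: mult_ac)
  also have "\<dots> \<le> (\<Sum>U\<in>UNIV. p U * c S)"
    by (intro sum_mono mult_left_mono S p)
  also have "\<dots> = c S"
    by (simp add: sum_distrib_right[symmetric] p(2))
  finally have cut_S: "alpha_GW * \<rho> \<le> c S" .
  define y where "y U = p U / alpha_GW" for U
  have y_nonneg: "0 \<le> y U" for U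
    using p(1) alpha_GW_pos by (simp add: y_def)
  have y_cut: "z e \<le> (\<Sum>U\<in>UNIV. y U * indicator (cut E U) e)" if "e \<in> E" for e
  proof -
    have "(\<Sum>U\<in>UNIV. y U * indicator (cut E U) e)
      = (\<Sum>U\<in>UNIV. p U * indicator (cut E U) e) / alpha_GW"
      by (simp only: y_def sum_divide_distrib times_divide_eq_left)
    then show ?thesis
      using p_cut[OF that] alpha_GW_pos by (simp add: pos_le_divide_eq mult.commute)
  qed
  have y_sum: "(\<Sum>U\<in>UNIV. y U) = 1 / alpha_GW"
    by (simp add: y_def sum_divide_distrib[symmetric] p(2))
  have z_nonzero: "\<not> zero_on E z"
  proof
    assume "zero_on E z"
    then have "(\<Sum>e\<in>E. w e * z e) = 0"
      by (simp add: zero_on_def)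
    then show False
      using \<rho>_pos wz by simp
  qed
  have nonneg: "nonneg_on E z"
    using z_nonneg by (simp add: nonneg_on_def)
  \<comment> \<open>Both sides of the condition on zeros are false, as \<open>\<rho>\<close> is
    positive and \<open>w\<close> nonzero.\<close>
  have "is_certificate alpha_GW E w z (\<rho>, 1, S, y, x)"
    unfolding is_certificate_def
    using alpha_GW_pos alpha_GW_le_1 assms nonneg \<rho>_pos wz cut_S y_cut y_sum x(1)
      psd_Diag_minus_laplacian[OF x(2)] y_nonneg
    by (auto simp: c_def)
  moreover have "z \<in> Z_set E w"
    using nonneg wz by (simp add: Z_set_def GW polar)
  ultimately show ?thesis
    using z_nonzero by blast
qed

end
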